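(* Let $\gamma\ge 0$ and let $f\in \dot H^{-2}(\Omega)\setminus\mathbb{S}_\gamma$ be time-independent. Let $T,\tilde T>0$ and $u_0,\tilde u_0\in L^2(\Omega)\cap\mathbb{S}_{\gamma+1}$, and let $u$, $\tilde u$ be the solutions of problem (P) with source $f$ and initial data $u_0$, $\tilde u_0$ respectively. If $u(T)=\tilde u(\tilde T)$, then $T=\tilde T$ and $u_0=\tilde u_0$.
   Context: Let $\Omega\subset\mathbb{R}^d$ ($d=1,2,3$) be an open bounded smooth domain, $\alpha\in(0,1)$, and $q\in L^\infty(\Omega)$, $q\ge 0$, a fixed known potential. Let $A=-\Delta+q$ with zero Dirichlet boundary condition on $L^2(\Omega)$, with eigenvalues $0<\lambda_1\le\lambda_2\le\dots\to\infty$ (multiplicity counted) and $L^2(\Omega)$-orthonormal eigenfunctions $\{\varphi_n\}$. For $s\ge0$, $\dot H^s(\Omega)=\{v\in L^2(\Omega):\|v\|_{\dot H^s}^2=\sum_n\lambda_n^s(v,\varphi_n)^2<\infty\}$, and $\dot H^{-s}(\Omega)$ is its dual; $(\cdot,\cdot)$ denotes the $L^2$ inner product and the duality pairing. The Mittag-Leffler function is $E_{\alpha,\beta}(z)=\sum_{k\ge0}z^k/\Gamma(k\alpha+\beta)$. Define $F(t)v=\sum_n E_{\alpha,1}(-\lambda_nt^\alpha)(v,\varphi_n)\varphi_n$ and $E(t)v=\sum_n t^{\alpha-1}E_{\alpha,\alpha}(-\lambda_nt^\alpha)(v,\varphi_n)\varphi_n$. Problem (P) is $\partial_t^\alpha u-\Delta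 u+qu=f$ in $\Omega\times(0,\infty)$, $u=0$ on $\partial\Omega$, $u(0)=u_0$, where $\partial_t^\alpha u(t)=\frac1{\Gamma(1-\alpha)}\int_0^t(t-s)^{-\alpha}u'(s)\,ds$ is the Caputo derivative; its solution is $u(t)=F(t)u_0+\int_0^tE(t-s)f(s)\,ds$, which for time-independent $f$ equals $F(t)u_0+A^{-1}(I-F(t))f$. For $\gamma\ge -1$, $\mathbb{S}_\gamma=\{v\in\dot H^{-2}(\Omega):\lim_{n\to\infty}\lambda_n^\gamma|(v,\varphi_n)|=0\}$. *)

theory Defs
  imports "HOL-Analysis.Analysis"
begin

text \<open>Spectral setting. Elements of the spaces \<open>\<dot>H^s(\<Omega>)\<close> (s \<ge> -2) are represented
  by their coefficient sequences \<open>n \<mapsto> (v,\<phi>_n)\<close> with respect to the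
  L2-orthonormal eigenbasis of \<open>A = -\<Delta> + q\<close>; \<open>lam n\<close> is the n-th eigenvalue
  (multiplicity counted, nondecreasing, positive, tending to infinity).\<close>

definition dirichlet_spectrum :: "(nat \<Rightarrow> real) \<Rightarrow> bool" where
  "dirichlet_spectrum lam \<longleftrightarrow> (\<forall>n. 0 < lam n) \<and> mono lam \<and> filterlim lam at_top sequentially"

definition mittag_leffler :: "real \<Rightarrow> real \<Rightarrow> real \<Rightarrow> real" where
  "mittag_leffler \<alpha> \<beta> z = (\<Sum>k. z ^ k / Gamma (real k * \<alpha> + \<beta>))"

definition in_Hdot :: "(nat \<Rightarrow> real) \<Rightarrow> real \<Rightarrow> (nat \<Rightarrow> real) \<Rightarrow> bool" where
  "in_Hdot lam s v \<longleftrightarrow> summable (\<lambda>n. lam n powr s * (v n)\<^sup>2)"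

definition in_L2 :: "(nat \<Rightarrow> real) \<Rightarrow> bool" where
  "in_L2 v \<longleftrightarrow> summable (\<lambda>n. (v n)\<^sup>2)"

definition in_S :: "(nat \<Rightarrow> real) \<Rightarrow> real \<Rightarrow> (nat \<Rightarrow> real) \<Rightarrow> bool" where
  "in_S lam \<gamma> v \<longleftrightarrow> in_Hdot lam (-2) v \<and> (\<lambda>n. lam n powr \<gamma> * \<bar>v n\<bar>) \<longlonglongrightarrow> 0"

text \<open>Solution of (P) with time-independent source f:
  \<open>u(t) = F(t)u_0 + A^{-1}(I - F(t)) f\<close>, in coefficients.\<close>
definition sol_P :: "real \<Rightarrow> (nat \<Rightarrow> real) \<Rightarrow> (nat \<Rightarrow> real) \<Rightarrow> (nat \<Rightarrow> real) \<Rightarrow> real \<Rightarrow> nat \<Rightarrow> real" where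
  "sol_P \<alpha> lam u0 f t n =
     mittag_leffler \<alpha> 1 (- lam n * t powr \<alpha>) * u0 n
     + (1 - mittag_leffler \<alpha> 1 (- lam n * t powr \<alpha>)) * f n / lam n"

end

theory Submission
  imports Defs "HOL-Real_Asymp.Real_Asymp"
begin

text \<open>
  Write \<open>e(x) = E\<^bsub>\<alpha>,1\<^esub>(-x)\<close>. Two properties of \<open>e\<close> suffice: \<open>e > 0\<close> on \<open>[0,\<infinity>)\<close>, and
  \<open>x e(x) \<longlongrightarrow> 1 / \<Gamma>(1 - \<alpha>)\<close> as \<open>x \<longlongrightarrow> \<infinity>\<close>. By the second, the coefficients of \<open>u(T) - u'(T')\<close>
  multiplied by \<open>\<lambda>\<^sub>n\<^bsup>\<gamma>+2\<^esup>\<close> differ from \<open>c (T'\<^bsup>-\<alpha>\<^esup> - T\<^bsup>-\<alpha>\<^esup>) \<lambda>\<^sub>n\<^bsup>\<gamma>\<^esup> f\<^sub>n\<close> by a relatively small error plus a null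
  sequence, which forces \<open>T = T'\<close>; then \<open>u\<^sub>0\<close> is recovered by dividing by \<open>e > 0\<close>.

  Since \<open>e(t\<^sup>\<alpha>)\<close> has fractional derivative \<open>-e(t\<^sup>\<alpha>)\<close>, and the Marchaud form of that derivative is
  nonpositive at a point where a function attains its minimum over the past, minimum principles
  give that \<open>e\<close> is positive and decreasing. Integrating the equation shows
  \<open>x \<integral>\<^sub>0\<^sup>1 e(x\<theta>\<^sup>\<alpha>) d\<theta> \<longlongrightarrow> 1 / \<Gamma>(2 - \<alpha>)\<close>, and monotonicity of \<open>e\<close> allows one to differentiate this
  asymptotic relation.
\<close>

section \<open>Convergence of the Mittag-Leffler series\<close>

text \<open>Log-convexity: the slope of ln Gamma over [y, y + \<alpha>] is at least its slope over
  [y - 1, y], which is ln (y - 1) by the functional equation.\<close>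

lemma Gamma_ratio_ge_powr:
  fixes y \<alpha> :: real
  assumes "y > 1" "\<alpha> > 0"
  shows "(y - 1) powr \<alpha> * Gamma y \<le> Gamma (y + \<alpha>)"
proof -
  let ?f = "ln \<circ> Gamma :: real \<Rightarrow> real"
  have pos: "Gamma y > 0" "Gamma (y - 1) > 0" "Gamma (y + \<alpha>) > 0"
    using assms by (auto intro: Gamma_real_pos)
  have "(?f (y - 1) - ?f y) / ((y - 1) - y) \<le> (?f y - ?f (y + \<alpha>)) / (y - (y + \<alpha>))"
    using convex_on_slope_le[OF log_convex_Gamma_real, of "y - 1" "y + \<alpha>" y] assms by fastforce
  then have "\<alpha> * (?f y - ?f (y - 1)) \<le> ?f (y + \<alpha>) - ?f y"
    using assms by (simp add: field_simps)
  moreover have "Gamma y = (y - 1) * Gamma (y - 1)"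
    using Gamma_plus1[of "y - 1"] assms nonpos_Ints_nonpos[of "y - 1"] by auto
  then have "?f y - ?f (y - 1) = ln (y - 1)"
    using pos assms ln_mult_pos[of "y - 1" "Gamma (y - 1)"] by simp
  ultimately have "ln ((y - 1) powr \<alpha> * Gamma y) \<le> ln (Gamma (y + \<alpha>))"
    using pos assms ln_mult_pos[of "(y - 1) powr \<alpha>" "Gamma y"] by (simp add: ln_powr)
  then show ?thesis
    using pos assms by (subst (asm) ln_le_cancel_iff) auto
qed

text \<open>Ratio test: consecutive terms have ratio |z| Gamma y / Gamma (y + \<alpha>) \<le> |z| /
  (y - 1)^\<alpha> in absolute value, which tends to 0.\<close>

lemma summable_mittag_leffler:
  fixes \<alpha> \<beta> z :: real
  assumes "\<alpha> > 0" "\<beta> > 0"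
  shows "summable (\<lambda>k. z ^ k / Gamma (real k * \<alpha> + \<beta>))"
proof -
  have "filterlim (\<lambda>k. (real k * \<alpha> + \<beta> - 1) powr \<alpha>) at_top sequentially"
    using assms by real_asymp
  then have "eventually (\<lambda>k. 2 * \<bar>z\<bar> \<le> (real k * \<alpha> + \<beta> - 1) powr \<alpha>) sequentially"
    by (simp add: filterlim_at_top)
  moreover have "eventually (\<lambda>k. real k * \<alpha> + \<beta> > 1) sequentially"
    using assms by real_asymp
  ultimately have "eventually (\<lambda>k. 2 * \<bar>z\<bar> \<le> (real k * \<alpha> + \<beta> - 1) powr \<alpha> \<and> real k * \<alpha> + \<beta> > 1) sequentially"
    by eventually_elim auto
  then obtain N where N: "\<And>k. k \<ge> N \<Longrightarrow> 2 * \<bar>z\<bar> \<le> (real k * \<alpha> + \<beta> - 1) powr \<alpha> \<and> real k * \<alpha> + \<beta> > 1"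
    by (auto simp: eventually_sequentially)
  show ?thesis
  proof (rule summable_ratio_test[of "1/2" N])
    fix k assume "k \<ge> N"
    define y where "y = real k * \<alpha> + \<beta>"
    have y: "2 * \<bar>z\<bar> \<le> (y - 1) powr \<alpha>" "y > 1" using N[OF \<open>k \<ge> N\<close>] by (auto simp: y_def)
    have pos: "Gamma y > 0" "Gamma (y + \<alpha>) > 0" using y assms by (auto intro: Gamma_real_pos)
    have "2 * \<bar>z\<bar> * Gamma y \<le> (y - 1) powr \<alpha> * Gamma y"
      using y pos by (intro mult_right_mono) auto
    also have "\<dots> \<le> Gamma (y + \<alpha>)" by (rule Gamma_ratio_ge_powr) (use y assms in auto)
    finally have "\<bar>z\<bar> / Gamma (y + \<alpha>) \<le> 1/2 * (1 / Gamma y)"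
      using pos by (simp add: field_simps)
    then have "\<bar>z\<bar> ^ k * (\<bar>z\<bar> / Gamma (y + \<alpha>)) \<le> \<bar>z\<bar> ^ k * (1/2 * (1 / Gamma y))"
      by (intro mult_left_mono) auto
    moreover have "real (Suc k) * \<alpha> + \<beta> = y + \<alpha>" by (simp add: y_def algebra_simps)
    ultimately show "norm (z ^ Suc k / Gamma (real (Suc k) * \<alpha> + \<beta>)) \<le> 1/2 * norm (z ^ k / Gamma (real k * \<alpha> + \<beta>))"
      using pos unfolding y_def[symmetric] by (simp add: power_abs abs_mult mult_ac)
  qed simp
qed

lemma mittag_leffler_sums:
  assumes "\<alpha> > 0" "\<beta> > 0"
  shows "(\<lambda>k. z ^ k / Gamma (real k * \<alpha> + \<beta>)) sums mittag_leffler \<alpha> \<beta> z"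
  unfolding mittag_leffler_def using summable_mittag_leffler[OF assms] by (rule summable_sums)

lemma continuous_on_mittag_leffler:
  assumes "\<alpha> > 0" "\<beta> > 0"
  shows "continuous_on A (mittag_leffler \<alpha> \<beta>)"
proof -
  have "isCont (\<lambda>z. \<Sum>k. (1 / Gamma (real k * \<alpha> + \<beta>)) * z ^ k) z" for z :: real
    by (rule isCont_powser_converges_everywhere) (use summable_mittag_leffler[OF assms] in simp)
  then show ?thesis
    unfolding mittag_leffler_def by (intro continuous_at_imp_continuous_on) auto
qed

section \<open>Term-by-term integration and integral identities\<close>

text \<open>Since \<open>g k\<close> is nonnegative, \<open>\<bar>a k\<bar> * c k\<close> is the L1
  norm of the k-th term, so the last two hypotheses justify exchanging sum and integral even for
  coefficients of varying sign.\<close>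

lemma has_integral_suminf_nonneg:
  fixes g :: "nat \<Rightarrow> 'a::euclidean_space \<Rightarrow> real"
  assumes S: "S \<in> sets lebesgue"
    and g: "\<And>k. (g k has_integral c k) S" "\<And>k x. x \<in> S \<Longrightarrow> 0 \<le> g k x"
    and "\<And>x. x \<in> S \<Longrightarrow> summable (\<lambda>k. \<bar>a k\<bar> * g k x)"
    and "summable (\<lambda>k. \<bar>a k\<bar> * c k)"
  shows "((\<lambda>x. \<Sum>k. a k * g k x) has_integral (\<Sum>k. a k * c k)) S"
proof -
  let ?M = "lebesgue_on S"
  have int: "integrable ?M (g k)" for k
  proof -
    have "g k absolutely_integrable_on S"
      using g by (intro nonnegative_absolutely_integrable_1) auto
    then show ?thesis using S by (simp add: integrable_restrict_space set_integrable_def)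
  qed
  have c: "integral\<^sup>L ?M (g k) = c k" for k
    using lebesgue_integral_eq_integral[OF int S] g(1) by auto
  have n: "norm (a k * g k x) = \<bar>a k\<bar> * g k x" if "x \<in> S" for k x
    using g(2)[OF that] by (simp add: abs_mult)
  have nc: "(\<integral>x. norm (a k * g k x) \<partial>?M) = \<bar>a k\<bar> * c k" for k
  proof -
    have "(\<integral>x. norm (a k * g k x) \<partial>?M) = (\<integral>x. \<bar>a k\<bar> * g k x \<partial>?M)"
      by (rule Bochner_Integration.integral_cong) (use n in auto)
    then show ?thesis by (simp add: c)
  qed
  have *: "\<And>k. integrable ?M (\<lambda>x. a k * g k x)"
    "AE x in ?M. summable (\<lambda>k. norm (a k * g k x))"
    "summable (\<lambda>k. \<integral>x. norm (a k * g k x) \<partial>?M)"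
    using int assms(4,5) n by (auto intro!: AE_I2 simp: nc simp del: real_norm_def)
  have "((\<lambda>x. \<Sum>k. a k * g k x) has_integral (\<integral>x. (\<Sum>k. a k * g k x) \<partial>?M)) S"
    by (intro has_integral_integral_lebesgue_on integrable_suminf * S)
  also have "(\<integral>x. (\<Sum>k. a k * g k x) \<partial>?M) = (\<Sum>k. a k * c k)"
    by (subst integral_suminf[OF *]) (simp add: c)
  finally show ?thesis .
qed

lemma mult_powr_power:
  fixes z \<theta> \<alpha> :: real
  assumes "\<theta> > 0"
  shows "(z * \<theta> powr \<alpha>) ^ k = z ^ k * \<theta> powr (real k * \<alpha>)"
  using assms by (simp add: power_mult_distrib powr_power mult.commute)

text \<open>A fractional integral of order b, scaled to the unit interval. The Beta integral of the
  k-th term replaces Gamma (k \<alpha> + 1) by Gamma (k \<alpha> + 1 + b) in the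
  denominator.\<close>

lemma has_integral_mittag_leffler_Beta:
  assumes "\<alpha> > 0" "b > 0"
  shows "((\<lambda>\<theta>. mittag_leffler \<alpha> 1 (z * \<theta> powr \<alpha>) * (1 - \<theta>) powr (b - 1))
           has_integral Gamma b * mittag_leffler \<alpha> (1 + b) z) {0<..<1}"
proof -
  let ?a = "\<lambda>z k. z ^ k / Gamma (real k * \<alpha> + 1)"
  let ?g = "\<lambda>k \<theta>. \<theta> powr (real k * \<alpha>) * (1 - \<theta>) powr (b - 1)"
  let ?c = "\<lambda>k. Beta (real k * \<alpha> + 1) b"
  have ac: "?a z k * ?c k = Gamma b * (z ^ k / Gamma (real k * \<alpha> + (1 + b)))" for z k
  proof -
    have "Gamma (real k * \<alpha> + 1) > 0" using assms by (intro Gamma_real_pos add_nonneg_pos) auto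
    then show ?thesis by (simp add: Beta_def add_ac)
  qed
  \<comment> \<open>The denominators are positive, so absolute convergence at z is convergence of
    the same series at |z|; hence the facts below are proved for every z.\<close>
  have abs_a: "\<bar>?a z k\<bar> = ?a \<bar>z\<bar> k" for k
  proof -
    have "Gamma (real k * \<alpha> + 1) > 0" using assms by (intro Gamma_real_pos add_nonneg_pos) auto
    then show ?thesis by (simp add: power_abs)
  qed
  have sums: "(\<lambda>k. ?a z k * ?c k) sums (Gamma b * mittag_leffler \<alpha> (1 + b) z)" for z
    unfolding ac by (intro sums_mult mittag_leffler_sums) (use assms in auto)
  have gs: "(\<lambda>k. ?a z k * ?g k \<theta>) sums (mittag_leffler \<alpha> 1 (z * \<theta> powr \<alpha>) * (1 - \<theta>) powr (b - 1))"
    if "\<theta> \<in> {0<..<1}" for \<theta> z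
    using sums_mult2[OF mittag_leffler_sums[of \<alpha> 1 "z * \<theta> powr \<alpha>"], of "(1 - \<theta>) powr (b - 1)"] that assms
    by (simp add: mult_powr_power mult_ac)
  have "((\<lambda>\<theta>. \<Sum>k. ?a z k * ?g k \<theta>) has_integral (\<Sum>k. ?a z k * ?c k)) {0<..<1}"
  proof (rule has_integral_suminf_nonneg)
    show "(?g k has_integral ?c k) {0<..<1}" for k
      using has_integral_Beta_real[of "real k * \<alpha> + 1" b] assms
      by (simp add: has_integral_Icc_iff_Ioo add_nonneg_pos)
    show "summable (\<lambda>k. \<bar>?a z k\<bar> * ?g k \<theta>)" if "\<theta> \<in> {0<..<1}" for \<theta>
      unfolding abs_a using gs[OF that] by (rule sums_summable)
    show "summable (\<lambda>k. \<bar>?a z k\<bar> * ?c k)"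
      unfolding abs_a using sums by (rule sums_summable)
  qed auto
  also have "(\<Sum>k. ?a z k * ?c k) = Gamma b * mittag_leffler \<alpha> (1 + b) z"
    by (rule sums_unique[OF sums, symmetric])
  finally show ?thesis
    by (rule has_integral_eq[rotated]) (rule sums_unique[OF gs, symmetric])
qed

text \<open>Integration by parts: the derivative of (1 - \<theta>^p) (1 - \<theta>)^(-\<alpha>) is
  \<alpha> times this integrand minus a Beta integrand. The result supplies the single terms of the
  Marchaud identity.\<close>

lemma has_integral_power_difference_quotient:
  fixes \<alpha> p :: real
  assumes "0 < \<alpha>" "\<alpha> < 1" "p > 0"
  shows "((\<lambda>\<theta>. (1 - \<theta> powr p) * (1 - \<theta>) powr (- \<alpha> - 1))
           has_integral (p * Beta p (1 - \<alpha>) - 1) / \<alpha>) {0<..<1}"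
proof -
  let ?H = "\<lambda>\<theta>::real. (1 - \<theta> powr p) * (1 - \<theta>) powr (- \<alpha>)"
  let ?H' = "\<lambda>\<theta>::real. \<alpha> * ((1 - \<theta> powr p) * (1 - \<theta>) powr (- \<alpha> - 1))
     - p * (\<theta> powr (p - 1) * (1 - \<theta>) powr (- \<alpha>))"
  \<comment> \<open>Here \<open>?H 0\<close> is 1 and \<open>?H 1\<close> is 0. The latter is also
    the left limit, because 1 - \<theta>^p vanishes to first order at 1 and \<alpha> < 1.\<close>
  have "(?H' has_integral (?H 1 - ?H 0)) {0..1}"
  proof (rule fundamental_theorem_of_calculus_interior)
    show "(?H has_vector_derivative ?H' \<theta>) (at \<theta>)" if "\<theta> \<in> {0<..<1}" for \<theta>
    proof -
      have "((\<lambda>\<theta>. (1 - \<theta>) powr (- \<alpha>)) has_real_derivative - \<alpha> * (1 - \<theta>) powr (- \<alpha> - of_nat 1) * - 1) (at \<theta>)"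
        using that by (intro DERIV_fun_powr) (auto intro!: derivative_eq_intros)
      moreover have "((\<lambda>\<theta>. 1 - \<theta> powr p) has_real_derivative 0 - p * \<theta> powr (p - 1)) (at \<theta>)"
        using that by (intro DERIV_diff DERIV_const has_real_derivative_powr) auto
      ultimately have "(?H has_real_derivative ?H' \<theta>) (at \<theta>)"
        using DERIV_mult by (fastforce simp: algebra_simps)
      then show ?thesis
        unfolding has_real_derivative_iff_has_vector_derivative .
    qed
    show "continuous_on {0..1} ?H"
    proof (rule continuous_on_IccI)
      show "(?H \<longlongrightarrow> ?H 0) (at_right 0)" using assms by simp real_asymp
      have "(?H \<longlongrightarrow> 0) (at_left 1)" 
      proof (rule Lim_transform_eventually)
        have "((\<lambda>\<theta>. \<theta> powr p) has_real_derivative p * 1 powr (p - 1)) (at 1)"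
          by (rule has_real_derivative_powr) simp
        then have "((\<lambda>\<theta>. (\<theta> powr p - 1) / (\<theta> - 1)) \<longlongrightarrow> p) (at_left 1)"
          by (simp add: has_field_derivative_iff filterlim_at_split)
        moreover have "((\<lambda>\<theta>::real. (1 - \<theta>) powr (1 - \<alpha>)) \<longlongrightarrow> 0) (at_left 1)"
          using assms by real_asymp
        ultimately show "((\<lambda>\<theta>. (\<theta> powr p - 1) / (\<theta> - 1) * (1 - \<theta>) powr (1 - \<alpha>)) \<longlongrightarrow> 0) (at_left 1)"
          using tendsto_mult by fastforce
        show "\<forall>\<^sub>F \<theta> in at_left 1. (\<theta> powr p - 1) / (\<theta> - 1) * (1 - \<theta>) powr (1 - \<alpha>) = ?H \<theta>"
          unfolding eventually_at_left_field
          by (intro exI[of _ 0]) (auto simp: powr_diff powr_minus divide_simps, auto simp: algebra_simps)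
      qed
      then show "(?H \<longlongrightarrow> ?H 1) (at_left 1)" by simp
      show "?H \<midarrow>\<theta>\<rightarrow> ?H \<theta>" if "0 < \<theta>" "\<theta> < 1" for \<theta>
        using that by (intro tendsto_intros) auto
    qed simp
  qed simp
  then have 1: "(?H' has_integral - 1) {0<..<1}"
    by (simp add: has_integral_Icc_iff_Ioo)
  have 2: "((\<lambda>\<theta>. p * (\<theta> powr (p - 1) * (1 - \<theta>) powr (- \<alpha>))) has_integral p * Beta p (1 - \<alpha>)) {0<..<1}"
    using has_integral_Beta_real[of p "1 - \<alpha>"] assms
    by (intro has_integral_mult_right) (simp add: has_integral_Icc_iff_Ioo)
  have "((\<lambda>\<theta>. \<alpha> * ((1 - \<theta> powr p) * (1 - \<theta>) powr (- \<alpha> - 1))) has_integral (p * Beta p (1 - \<alpha>) - 1)) {0<..<1}"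
    using has_integral_add[OF 1 2] by simp
  from has_integral_mult_right[OF this, of "1 / \<alpha>"] show ?thesis
    using assms by simp
qed


text \<open>The fractional differential equation of \<open>t \<mapsto> E\<^bsub>\<alpha>,1\<^esub>(\<lambda>t\<^sup>\<alpha>)\<close> with the Caputo derivative
  integrated by parts, so that only differences of values occur; here \<open>z = \<lambda>t\<^sup>\<alpha>\<close> and \<open>s = \<theta>t\<close>.\<close>

lemma has_integral_mittag_leffler_marchaud:
  assumes "0 < \<alpha>" "\<alpha> < 1"
  shows "((\<lambda>\<theta>. (mittag_leffler \<alpha> 1 z - mittag_leffler \<alpha> 1 (z * \<theta> powr \<alpha>)) * (1 - \<theta>) powr (- \<alpha> - 1))
           has_integral (Gamma (1 - \<alpha>) * z * mittag_leffler \<alpha> 1 z - mittag_leffler \<alpha> 1 z + 1) / \<alpha>) {0<..<1}"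
proof -
  let ?E = "mittag_leffler \<alpha> 1"
  let ?a = "\<lambda>z k. z ^ k / Gamma (real k * \<alpha> + 1)"
  let ?g = "\<lambda>k \<theta>. (1 - \<theta> powr (real k * \<alpha>)) * (1 - \<theta>) powr (- \<alpha> - 1)"
  \<comment> \<open>For k = 0 the difference vanishes, whereas the general formula would evaluate to
    -1/\<alpha>.\<close>
  define c where "c k = (if k = 0 then 0 else (real k * \<alpha> * Beta (real k * \<alpha>) (1 - \<alpha>) - 1) / \<alpha>)" for k
  have G: "Gamma (real k * \<alpha> + 1) > 0" for k
    using assms by (intro Gamma_real_pos add_nonneg_pos) auto
  have abs_a: "\<bar>?a z k\<bar> = ?a \<bar>z\<bar> k" for k
    using G[of k] by (simp add: power_abs)
  \<comment> \<open>With p = (k + 1) \<alpha>, the identity p + (1 - \<alpha>) = k \<alpha> + 1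
    lowers the index by one; this shift is the source of the term z E(z).\<close>
  have ac: "?a z (Suc k) * c (Suc k) = (Gamma (1 - \<alpha>) * z * ?a z k - ?a z (Suc k)) / \<alpha>" for z k
  proof -
    define p where "p = real (Suc k) * \<alpha>"
    have "p > 0" using assms by (simp add: p_def)
    have "p \<notin> \<int>\<^sub>\<le>\<^sub>0" using nonpos_Ints_nonpos[of p] \<open>p > 0\<close> by auto
    then have "p * Gamma p = Gamma (p + 1)" by (simp add: Gamma_plus1)
    moreover have "p + (1 - \<alpha>) = real k * \<alpha> + 1" by (simp add: p_def algebra_simps)
    ultimately have "p * Beta p (1 - \<alpha>) = Gamma (p + 1) * Gamma (1 - \<alpha>) / Gamma (real k * \<alpha> + 1)"
      by (simp only: Beta_def times_divide_eq_right mult.assoc[symmetric])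
    moreover have "c (Suc k) = (p * Beta p (1 - \<alpha>) - 1) / \<alpha>" by (simp add: c_def p_def)
    ultimately have c: "c (Suc k) = (Gamma (p + 1) * Gamma (1 - \<alpha>) / Gamma (real k * \<alpha> + 1) - 1) / \<alpha>"
      by simp
    have "Gamma (p + 1) > 0" using \<open>p > 0\<close> by (intro Gamma_real_pos) auto
    then have "z ^ Suc k / Gamma (p + 1) * c (Suc k)
        = (Gamma (1 - \<alpha>) * z * ?a z k - z ^ Suc k / Gamma (p + 1)) / \<alpha>"
      unfolding c using G[of k] assms by (simp add: field_simps)
    then show ?thesis by (simp only: p_def)
  qed
  have E: "?a z sums ?E z" for z
    by (rule mittag_leffler_sums) (use assms in auto)
  have sums: "(\<lambda>k. ?a z k * c k) sums ((Gamma (1 - \<alpha>) * z * ?E z - ?E z + 1) / \<alpha>)" for z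
  proof -
    \<comment> \<open>The missing k = 0 term equals 1 and accounts for the + 1 in the value of the
      integral.\<close>
    have "(\<lambda>k. ?a z (Suc k)) sums (?E z - 1)"
      using E[of z] by (subst sums_Suc_iff) simp
    then have "(\<lambda>k. ?a z (Suc k) * c (Suc k)) sums ((Gamma (1 - \<alpha>) * z * ?E z - (?E z - 1)) / \<alpha>)"
      unfolding ac by (intro sums_divide sums_diff sums_mult E)
    then show ?thesis
      by (subst (asm) sums_Suc_iff) (simp add: c_def algebra_simps)
  qed
  have gs: "(\<lambda>k. ?a z k * ?g k \<theta>) sums ((?E z - ?E (z * \<theta> powr \<alpha>)) * (1 - \<theta>) powr (- \<alpha> - 1))"
    if "\<theta> \<in> {0<..<1}" for \<theta> z
  proof -
    have eq: "?a (z * \<theta> powr \<alpha>) k = ?a z k * \<theta> powr (real k * \<alpha>)" for k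
      using that by (simp add: mult_powr_power)
    have "(\<lambda>k. ?a z k - ?a z k * \<theta> powr (real k * \<alpha>)) sums (?E z - ?E (z * \<theta> powr \<alpha>))"
      using sums_diff[OF E E, of z "z * \<theta> powr \<alpha>"] unfolding eq .
    from sums_mult2[OF this, of "(1 - \<theta>) powr (- \<alpha> - 1)"] show ?thesis
      by (simp add: algebra_simps)
  qed
  have "((\<lambda>\<theta>. \<Sum>k. ?a z k * ?g k \<theta>) has_integral (\<Sum>k. ?a z k * c k)) {0<..<1}"
  proof (rule has_integral_suminf_nonneg)
    show "(?g k has_integral c k) {0<..<1}" for k
    proof (cases "k = 0")
      case True
      then have "c k = 0" by (simp add: c_def)
      moreover have "(?g k has_integral 0) {0<..<1}"
        by (rule has_integral_is_0) (use True in auto)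
      ultimately show ?thesis by (simp only:)
    next
      case False
      then show ?thesis
        using has_integral_power_difference_quotient[of \<alpha> "real k * \<alpha>"] assms by (simp add: c_def)
    qed
    have "summable (\<lambda>k. ?a \<bar>z\<bar> k * c k)" using sums by (rule sums_summable)
    then show "summable (\<lambda>k. \<bar>?a z k\<bar> * c k)" by (simp only: abs_a)
    fix \<theta> :: real assume \<theta>: "\<theta> \<in> {0<..<1}"
    have "summable (\<lambda>k. ?a \<bar>z\<bar> k * ?g k \<theta>)" using gs[OF \<theta>] by (rule sums_summable)
    then show "summable (\<lambda>k. \<bar>?a z k\<bar> * ?g k \<theta>)" by (simp only: abs_a)
    show "0 \<le> ?g k \<theta>" for k
      using \<theta> assms by (intro mult_nonneg_nonneg) (auto intro!: powr_le1)
  qed auto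
  also have "(\<Sum>k. ?a z k * c k) = (Gamma (1 - \<alpha>) * z * ?E z - ?E z + 1) / \<alpha>"
    by (rule sums_unique[OF sums, symmetric])
  finally show ?thesis
    by (rule has_integral_eq[rotated]) (rule sums_unique[OF gs, symmetric])
qed

section \<open>Minimum principles: positivity and monotonicity\<close>

lemma mult_powr_in_Icc:
  fixes \<theta> \<alpha> x :: real
  assumes "\<theta> \<in> {0<..<1}" "0 < \<alpha>" "0 \<le> x"
  shows "x * \<theta> powr \<alpha> \<in> {0..x}"
  using assms by (auto intro!: mult_left_le powr_le1)

text \<open>At a nonpositive minimum over [0, x] the Marchaud integrand is nonpositive, yet its
  integral is at least 1/\<alpha>.\<close>

lemma mittag_leffler_neg_pos:
  assumes "0 < \<alpha>" "\<alpha> < 1" "0 \<le> x"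
  shows "mittag_leffler \<alpha> 1 (- x) > 0"
proof (rule ccontr)
  assume neg: "\<not> ?thesis"
  let ?e = "\<lambda>x. mittag_leffler \<alpha> 1 (- x)"
  have "continuous_on {0..x} ?e"
    using assms by (intro continuous_on_compose2[OF continuous_on_mittag_leffler[of \<alpha> 1 UNIV]]) (auto intro!: continuous_intros)
  then obtain y where y: "y \<in> {0..x}" and min: "\<And>w. w \<in> {0..x} \<Longrightarrow> ?e y \<le> ?e w"
    using continuous_attains_inf[of "{0..x}" ?e] assms by auto
  have ey: "?e y \<le> 0" using min[of x] neg assms by auto
  have "(Gamma (1 - \<alpha>) * (- y) * ?e y - ?e y + 1) / \<alpha> \<le> 0"
  proof (rule has_integral_le)
    show "((\<lambda>\<theta>. (?e y - mittag_leffler \<alpha> 1 (- y * \<theta> powr \<alpha>)) * (1 - \<theta>) powr (- \<alpha> - 1))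
        has_integral (Gamma (1 - \<alpha>) * (- y) * ?e y - ?e y + 1) / \<alpha>) {0<..<1}"
      by (rule has_integral_mittag_leffler_marchaud) fact+
    show "((\<lambda>\<theta>. 0) has_integral 0) {0<..<1::real}" by simp
    fix \<theta> :: real assume "\<theta> \<in> {0<..<1}"
    from mult_powr_in_Icc[OF this, of \<alpha> y] y assms have "y * \<theta> powr \<alpha> \<in> {0..x}" by auto
    from min[OF this] show "(?e y - mittag_leffler \<alpha> 1 (- y * \<theta> powr \<alpha>)) * (1 - \<theta>) powr (- \<alpha> - 1) \<le> 0"
      by (intro mult_nonpos_nonneg) auto
  qed
  moreover have "Gamma (1 - \<alpha>) * (- y) * ?e y \<ge> 0"
    using y ey assms Gamma_real_pos[of "1 - \<alpha>"] by (intro mult_nonpos_nonpos) auto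
  ultimately show False using assms ey by (auto simp: divide_le_0_iff)
qed

text \<open>Comparison of two decay rates: at a negative minimum of the difference
  \<open>y \<mapsto> e(\<mu>y) - e(\<nu>y)\<close> the Marchaud identity would give \<open>\<nu> e(\<nu>y) < \<mu> e(\<mu>y)\<close>.\<close>

lemma mittag_leffler_neg_antimono:
  assumes "0 < \<alpha>" "\<alpha> < 1" "0 \<le> \<mu>" "\<mu> \<le> \<nu>"
  shows "mittag_leffler \<alpha> 1 (- \<nu>) \<le> mittag_leffler \<alpha> 1 (- \<mu>)"
proof (rule ccontr)
  assume neg: "\<not> ?thesis"
  let ?e = "\<lambda>x. mittag_leffler \<alpha> 1 (- x)"
  \<comment> \<open>The arguments are scaled so that the assumed failure of monotonicity is
    negativity of \<open>?d\<close> at y = 1.\<close>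
  let ?d = "\<lambda>y. ?e (\<mu> * y) - ?e (\<nu> * y)"
  have "continuous_on {0..1} (\<lambda>y. ?e (c * y))" for c
    using assms by (intro continuous_on_compose2[OF continuous_on_mittag_leffler[of \<alpha> 1 UNIV]]) (auto intro!: continuous_intros)
  then have "continuous_on {0..1} ?d" by (intro continuous_on_diff)
  then obtain y where y: "y \<in> {0..1}" and min: "\<And>w. w \<in> {0..1} \<Longrightarrow> ?d y \<le> ?d w"
    using continuous_attains_inf[of "{0..1}" ?d] by auto
  have dy: "?d y < 0" using min[of 1] neg by auto
  let ?I = "\<lambda>c. (Gamma (1 - \<alpha>) * (- (c * y)) * ?e (c * y) - ?e (c * y) + 1) / \<alpha>"
  let ?f = "\<lambda>c \<theta>. (?e (c * y) - mittag_leffler \<alpha> 1 (- (c * y) * \<theta> powr \<alpha>)) * (1 - \<theta>) powr (- \<alpha> - 1)"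
  have int: "(?f c has_integral ?I c) {0<..<1}" for c
    by (rule has_integral_mittag_leffler_marchaud) fact+
  have "?I \<mu> - ?I \<nu> \<le> 0"
  proof (rule has_integral_le)
    show "((\<lambda>\<theta>. ?f \<mu> \<theta> - ?f \<nu> \<theta>) has_integral (?I \<mu> - ?I \<nu>)) {0<..<1}"
      by (intro has_integral_diff int)
    show "((\<lambda>\<theta>. 0) has_integral 0) {0<..<1::real}" by simp
    fix \<theta> :: real assume "\<theta> \<in> {0<..<1}"
    from mult_powr_in_Icc[OF this, of \<alpha> y] y assms have "y * \<theta> powr \<alpha> \<in> {0..1}" by auto
    from min[OF this]
    have "(?d y - ?d (y * \<theta> powr \<alpha>)) * (1 - \<theta>) powr (- \<alpha> - 1) \<le> 0"
      by (intro mult_nonpos_nonneg) auto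
    then show "?f \<mu> \<theta> - ?f \<nu> \<theta> \<le> 0" by (simp add: algebra_simps)
  qed
  \<comment> \<open>In the difference of the two identities the constants 1 cancel and the undamped
    values of e combine to minus \<open>?d y\<close>.\<close>
  then have "(Gamma (1 - \<alpha>) * y * (\<nu> * ?e (\<nu> * y) - \<mu> * ?e (\<mu> * y)) - ?d y) / \<alpha> \<le> 0"
    by (simp add: algebra_simps flip: diff_divide_distrib)
  then have "Gamma (1 - \<alpha>) * y * (\<nu> * ?e (\<nu> * y) - \<mu> * ?e (\<mu> * y)) \<le> ?d y"
    using assms by (simp add: divide_le_0_iff)
  moreover have "\<mu> * ?e (\<mu> * y) \<le> \<nu> * ?e (\<nu> * y)"
    using assms dy y mittag_leffler_neg_pos[of \<alpha> "\<mu> * y"] by (intro mult_mono) auto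
  then have "Gamma (1 - \<alpha>) * y * (\<nu> * ?e (\<nu> * y) - \<mu> * ?e (\<mu> * y)) \<ge> 0"
    using y assms Gamma_real_pos[of "1 - \<alpha>"] by (intro mult_nonneg_nonneg) auto
  ultimately show False using dy by simp
qed

section \<open>Asymptotics at infinity\<close>

text \<open>A Tauberian argument: monotonicity squeezes u t between difference quotients of U over
  [s t, t] with s < 1 and over [t, s t] with s > 1. After scaling, their limits involve (s^r - 1) /
  (s - 1), which tends to r as s tends to 1.\<close>

lemma monotone_density:
  fixes u :: "real \<Rightarrow> real"
  assumes anti: "\<And>x y. 0 \<le> x \<Longrightarrow> x \<le> y \<Longrightarrow> u y \<le> u x"
    and int: "\<And>t. 0 < t \<Longrightarrow> (u has_integral U t) {0..t}"
    and lim: "((\<lambda>t. t powr (- r) * U t) \<longlongrightarrow> L) at_top"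
  shows "((\<lambda>t. t powr (1 - r) * u t) \<longlongrightarrow> r * L) at_top"
proof -
  \<comment> \<open>The scaled difference quotient of U between t and s t (see \<open>B_eq\<close>),
    arranged so that \<open>lim\<close> applies to both parts.\<close>
  define B where "B s t = (s powr r * ((s * t) powr (- r) * U (s * t)) - t powr (- r) * U t) / (s - 1)" for s t
  have B_lim: "(B s \<longlongrightarrow> (s powr r - 1) / (s - 1) * L) at_top" if "s > 0" "s \<noteq> 1" for s
  proof -
    have "filterlim (\<lambda>t. s * t) at_top at_top"
      using that by (intro filterlim_tendsto_pos_mult_at_top[OF tendsto_const] filterlim_ident)
    from filterlim_compose[OF lim this]
    have "((\<lambda>t. (s * t) powr (- r) * U (s * t)) \<longlongrightarrow> L) at_top" .
    then have "(B s \<longlongrightarrow> (s powr r * L - L) / (s - 1)) at_top"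
      unfolding B_def using that by (intro tendsto_intros lim) auto
    then show ?thesis by (simp add: algebra_simps)
  qed
  have B_eq: "B s t = t powr (- r) * ((U (s * t) - U t) / (s - 1))" if "s > 0" "t > 0" for s t
    using that by (simp add: B_def powr_mult powr_minus field_simps)
  have incr: "(b - a) * u b \<le> U b - U a" "U b - U a \<le> (b - a) * u a" if "0 < a" "a < b" for a b
  proof -
    have "u integrable_on {a..b}"
      using that by (intro integrable_on_subinterval[OF has_integral_integrable[OF int[of b]]]) auto
    then obtain J where J: "(u has_integral J) {a..b}" by (auto simp: integrable_on_def)
    have "(u has_integral (U a + J)) {0..b}"
      by (rule has_integral_combine[OF _ _ int J]) (use that in auto)
    then have "U a + J = U b" by (rule has_integral_unique) (use int that in simp)
    then have J_eq: "J = U b - U a" by simp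
    have const: "((\<lambda>_. c) has_integral (b - a) * c) {a..b}" for c
      using has_integral_const_real[of c a b] that by simp
    show "(b - a) * u b \<le> U b - U a"
      unfolding J_eq[symmetric] by (rule has_integral_le[OF const J]) (use that in \<open>simp add: anti\<close>)
    show "U b - U a \<le> (b - a) * u a"
      unfolding J_eq[symmetric] by (rule has_integral_le[OF J const]) (use that in \<open>simp add: anti\<close>)
  qed
  \<comment> \<open>Up to the factor t^(1 - r), \<open>B s t\<close> is the mean of u over [s t, t],
    where u is at least u t. For s > 1 the inequality reverses.\<close>
  have upper: "t powr (1 - r) * u t \<le> B s t" if "0 < s" "s < 1" "t > 0" for s t
  proof -
    have "s * t < t" using that by simp
    from incr(1)[OF _ this] that have "(1 - s) * (t * u t) \<le> U t - U (s * t)"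
      by (simp add: algebra_simps)
    then have "t * u t \<le> (U (s * t) - U t) / (s - 1)"
      using that by (simp add: field_simps)
    then have "t powr (- r) * (t * u t) \<le> B s t"
      unfolding B_eq[OF that(1,3)] by (intro mult_left_mono) auto
    then show ?thesis using that by (simp add: powr_diff powr_minus field_simps)
  qed
  have lower: "B s t \<le> t powr (1 - r) * u t" if "1 < s" "t > 0" for s t
  proof -
    have "t < s * t" "0 < s" using that by simp_all
    from incr(2)[OF that(2) this(1)] have "U (s * t) - U t \<le> (s - 1) * (t * u t)"
      by (simp add: algebra_simps)
    then have "(U (s * t) - U t) / (s - 1) \<le> t * u t"
      using that by (simp add: field_simps)
    then have "B s t \<le> t powr (- r) * (t * u t)"
      unfolding B_eq[OF \<open>0 < s\<close> that(2)] by (intro mult_left_mono) auto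
    then show ?thesis using that by (simp add: powr_diff powr_minus field_simps)
  qed
  have "((\<lambda>s. s powr r) has_real_derivative r * 1 powr (r - 1)) (at 1)"
    by (rule has_real_derivative_powr) simp
  then have D: "((\<lambda>s. (s powr r - 1) / (s - 1) * L) \<longlongrightarrow> r * L) (at 1)"
    by (intro tendsto_mult tendsto_const) (simp add: has_field_derivative_iff)
  show ?thesis
  \<comment> \<open>For each bound a, one s near 1 on the suitable side is fixed first by means of
    \<open>D\<close>; only then does t tend to infinity.\<close>
  proof (rule order_tendstoI)
    fix a assume "a < r * L"
    with D have "eventually (\<lambda>s. a < (s powr r - 1) / (s - 1) * L) (at_right 1)"
      by (intro order_tendstoD) (auto simp: filterlim_at_split)
    moreover have "eventually (\<lambda>s::real. s > 1) (at_right 1)"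
      by (simp add: eventually_at_right_less)
    ultimately have "eventually (\<lambda>s. s > 1 \<and> a < (s powr r - 1) / (s - 1) * L) (at_right 1)"
      by eventually_elim auto
    then obtain s where s: "s > 1" "a < (s powr r - 1) / (s - 1) * L"
      using eventually_happens trivial_limit_at_right_real by blast
    then have "eventually (\<lambda>t. a < B s t) at_top"
      by (intro order_tendstoD(1)[OF B_lim]) auto
    with eventually_gt_at_top[of 0] show "eventually (\<lambda>t. a < t powr (1 - r) * u t) at_top"
      by eventually_elim (use lower[OF s(1)] in force)
  next
    fix a assume "r * L < a"
    with D have "eventually (\<lambda>s. (s powr r - 1) / (s - 1) * L < a) (at_left 1)"
      by (intro order_tendstoD) (auto simp: filterlim_at_split)
    moreover have "eventually (\<lambda>s::real. 0 < s \<and> s < 1) (at_left 1)"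
      unfolding eventually_at_left_field by (intro exI[of _ 0]) auto
    ultimately have "eventually (\<lambda>s. 0 < s \<and> s < 1 \<and> (s powr r - 1) / (s - 1) * L < a) (at_left 1)"
      by eventually_elim auto
    then obtain s where s: "0 < s" "s < 1" "(s powr r - 1) / (s - 1) * L < a"
      using eventually_happens trivial_limit_at_left_real by blast
    then have "eventually (\<lambda>t. B s t < a) at_top"
      by (intro order_tendstoD(2)[OF B_lim]) auto
    with eventually_gt_at_top[of 0] show "eventually (\<lambda>t. t powr (1 - r) * u t < a) at_top"
      by eventually_elim (use upper[OF s(1,2)] in force)
  qed
qed

lemma mittag_leffler_shift:
  assumes "0 < \<alpha>" "0 < \<beta>"
  shows "mittag_leffler \<alpha> \<beta> z = 1 / Gamma \<beta> + z * mittag_leffler \<alpha> (\<alpha> + \<beta>) z"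
proof -
  have "(\<lambda>k. z * (z ^ k / Gamma (real k * \<alpha> + (\<alpha> + \<beta>)))) sums (z * mittag_leffler \<alpha> (\<alpha> + \<beta>) z)"
    using assms by (intro sums_mult mittag_leffler_sums) auto
  also have "(\<lambda>k. z * (z ^ k / Gamma (real k * \<alpha> + (\<alpha> + \<beta>)))) = (\<lambda>k. z ^ Suc k / Gamma (real (Suc k) * \<alpha> + \<beta>))"
    by (simp add: algebra_simps)
  finally have "(\<lambda>k. z ^ k / Gamma (real k * \<alpha> + \<beta>)) sums (z * mittag_leffler \<alpha> (\<alpha> + \<beta>) z + 1 / Gamma \<beta>)"
    by (subst (asm) sums_Suc_iff) simp
  then show ?thesis
    using mittag_leffler_sums[OF assms, of z] sums_unique2 by fastforce
qed

text \<open>By the shift formula the claim reduces to \<open>?R\<close> tending to 0. This is a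
  bootstrap: \<open>?R\<close> is a weighted integral of e, hence nonnegative, which gives e(x)
  \<le> C / x; inserted into the same integral, this bound gives \<open>?R\<close> = O(1/x).\<close>

lemma mittag_leffler_2_asymptotics:
  assumes "0 < \<alpha>" "\<alpha> < 1"
  shows "((\<lambda>x. x * mittag_leffler \<alpha> 2 (- x)) \<longlongrightarrow> 1 / Gamma (2 - \<alpha>)) at_top"
proof -
  let ?e = "\<lambda>x. mittag_leffler \<alpha> 1 (- x)"
  define C where "C = 1 / Gamma (2 - \<alpha>)"
  let ?R = "\<lambda>x. mittag_leffler \<alpha> (2 - \<alpha>) (- x)"
  have shift: "x * mittag_leffler \<alpha> 2 (- x) = C - ?R x" for x
    using mittag_leffler_shift[of \<alpha> "2 - \<alpha>" "- x"] assms by (simp add: C_def)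
  have G: "Gamma (1 - \<alpha>) > 0" using assms by (intro Gamma_real_pos) auto
  have int_R: "((\<lambda>\<theta>. ?e (x * \<theta> powr \<alpha>) * (1 - \<theta>) powr (- \<alpha>)) has_integral Gamma (1 - \<alpha>) * ?R x) {0<..<1}" for x
    using has_integral_mittag_leffler_Beta[of \<alpha> "1 - \<alpha>" "- x"] assms by simp
  have R_nonneg: "?R x \<ge> 0" if "x \<ge> 0" for x
  proof -
    have "Gamma (1 - \<alpha>) * ?R x \<ge> 0"
      by (rule has_integral_nonneg[OF int_R])
        (use that assms in \<open>auto intro!: mult_nonneg_nonneg less_imp_le[OF mittag_leffler_neg_pos]\<close>)
    then show ?thesis using G by (simp add: zero_le_mult_iff)
  qed
  have e_le: "?e x \<le> C / x" if "x > 0" for x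
  proof -
    have 1: "((\<lambda>\<theta>. ?e (x * \<theta> powr \<alpha>)) has_integral mittag_leffler \<alpha> 2 (- x)) {0<..<1}"
      by (rule has_integral_eq[OF _ has_integral_mittag_leffler_Beta[of \<alpha> 1 "- x", simplified]]) (use assms in auto)
    have 2: "((\<lambda>\<theta>. ?e x) has_integral ?e x) {0<..<1::real}"
      using has_integral_const_real[of "?e x" 0 1] by (simp add: has_integral_Icc_iff_Ioo)
    \<comment> \<open>The right side is the mean of e(x \<theta>^\<alpha>) over the unit interval,
      and e is decreasing.\<close>
    have "?e x \<le> mittag_leffler \<alpha> 2 (- x)"
    proof (rule has_integral_le[OF 2 1])
      fix \<theta> :: real assume "\<theta> \<in> {0<..<1}"
      from mult_powr_in_Icc[OF this, of \<alpha> x] that assms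
      show "?e x \<le> ?e (x * \<theta> powr \<alpha>)" by (intro mittag_leffler_neg_antimono) auto
    qed
    then have "x * ?e x \<le> x * mittag_leffler \<alpha> 2 (- x)" using that by simp
    also have "\<dots> \<le> C" using shift[of x] R_nonneg[of x] that by simp
    finally show ?thesis using that by (simp add: field_simps)
  qed
  have R_le: "?R x \<le> C * Beta (1 - \<alpha>) (1 - \<alpha>) / Gamma (1 - \<alpha>) * (1 / x)" if "x > 0" for x
  proof -
    \<comment> \<open>The bound C / (x \<theta>^\<alpha>) is singular at 0, but integrable against
      the weight because \<alpha> < 1.\<close>
    have "((\<lambda>\<theta>. \<theta> powr (- \<alpha>) * (1 - \<theta>) powr (- \<alpha>)) has_integral Beta (1 - \<alpha>) (1 - \<alpha>)) {0<..<1}"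
      using has_integral_Beta_real[of "1 - \<alpha>" "1 - \<alpha>"] assms by (simp add: has_integral_Icc_iff_Ioo)
    from has_integral_mult_right[OF this, of "C / x"]
    have "Gamma (1 - \<alpha>) * ?R x \<le> C / x * Beta (1 - \<alpha>) (1 - \<alpha>)"
    proof (rule has_integral_le[OF int_R])
      fix \<theta> :: real assume \<theta>: "\<theta> \<in> {0<..<1}"
      have "?e (x * \<theta> powr \<alpha>) \<le> C / (x * \<theta> powr \<alpha>)" using \<theta> that by (intro e_le) auto
      also have "\<dots> = C / x * \<theta> powr (- \<alpha>)" by (simp add: powr_minus field_simps)
      finally show "?e (x * \<theta> powr \<alpha>) * (1 - \<theta>) powr (- \<alpha>) \<le> C / x * (\<theta> powr (- \<alpha>) * (1 - \<theta>) powr (- \<alpha>))"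
        by (subst mult.assoc[symmetric]) (intro mult_right_mono, auto)
    qed
    then show ?thesis using G that by (simp add: field_simps)
  qed
  have "(?R \<longlongrightarrow> 0) at_top"
  proof (rule tendsto_sandwich)
    show "eventually (\<lambda>x. 0 \<le> ?R x) at_top"
      using eventually_ge_at_top[of 0] by eventually_elim (rule R_nonneg)
    show "eventually (\<lambda>x. ?R x \<le> C * Beta (1 - \<alpha>) (1 - \<alpha>) / Gamma (1 - \<alpha>) * (1 / x)) at_top"
      using eventually_gt_at_top[of 0] by eventually_elim (rule R_le)
    show "((\<lambda>x::real. C * Beta (1 - \<alpha>) (1 - \<alpha>) / Gamma (1 - \<alpha>) * (1 / x)) \<longlongrightarrow> 0) at_top"
      by real_asymp
  qed simp
  from tendsto_diff[OF tendsto_const this, of C] show ?thesis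
    unfolding shift by (simp add: C_def)
qed

text \<open>In the variable t with x = t^\<alpha>, the primitive of e(t^\<alpha>) is t
  E_{\<alpha>,2}(-t^\<alpha>), of order t^(1 - \<alpha>). The claim is
  \<open>monotone_density\<close> with r = 1 - \<alpha>, since (1 - \<alpha>) / Gamma (2 - \<alpha>)
  = 1 / Gamma (1 - \<alpha>).\<close>

lemma mittag_leffler_asymptotics:
  assumes "0 < \<alpha>" "\<alpha> < 1"
  shows "((\<lambda>x. x * mittag_leffler \<alpha> 1 (- x)) \<longlongrightarrow> 1 / Gamma (1 - \<alpha>)) at_top"
proof -
  let ?u = "\<lambda>t. mittag_leffler \<alpha> 1 (- (t powr \<alpha>))"
  have int: "(?u has_integral t * mittag_leffler \<alpha> 2 (- (t powr \<alpha>))) {0..t}" if "t > 0" for t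
  proof -
    have "((\<lambda>\<theta>. mittag_leffler \<alpha> 1 (- (t powr \<alpha>) * \<theta> powr \<alpha>)) has_integral mittag_leffler \<alpha> 2 (- (t powr \<alpha>))) {0<..<1}"
      by (rule has_integral_eq[OF _ has_integral_mittag_leffler_Beta[of \<alpha> 1 "- (t powr \<alpha>)", simplified]]) (use assms in auto)
    then have "((\<lambda>\<theta>. mittag_leffler \<alpha> 1 (- (t powr \<alpha>) * \<theta> powr \<alpha>)) has_integral mittag_leffler \<alpha> 2 (- (t powr \<alpha>))) {0..1}"
      by (simp add: has_integral_Icc_iff_Ioo)
    then have "((\<lambda>\<theta>. ?u (t * \<theta>)) has_integral mittag_leffler \<alpha> 2 (- (t powr \<alpha>))) {0..1}"
      by (rule has_integral_eq[rotated]) (use that in \<open>simp add: powr_mult\<close>)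
    moreover have "(\<lambda>x. x * t) ` {0..1} = {0..t}"
      using that image_mult_atLeastAtMost[of t 0 1] by (simp add: mult.commute[of _ t])
    ultimately show ?thesis
      using has_integral_stretch_real[of "\<lambda>\<theta>. ?u (t * \<theta>)" _ 0 1 "1 / t"] that by simp
  qed
  have "((\<lambda>t. t powr (1 - (1 - \<alpha>)) * ?u t) \<longlongrightarrow> (1 - \<alpha>) * (1 / Gamma (2 - \<alpha>))) at_top"
  proof (rule monotone_density[OF _ int])
    show "?u y \<le> ?u x" if "0 \<le> x" "x \<le> y" for x y
      using that assms by (intro mittag_leffler_neg_antimono powr_mono2) auto
    have "filterlim (\<lambda>t::real. t powr \<alpha>) at_top at_top"
      using assms by real_asymp
    from filterlim_compose[OF mittag_leffler_2_asymptotics[OF assms] this]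
    show "((\<lambda>t. t powr - (1 - \<alpha>) * (t * mittag_leffler \<alpha> 2 (- (t powr \<alpha>)))) \<longlongrightarrow> 1 / Gamma (2 - \<alpha>)) at_top"
    proof (rule Lim_transform_eventually)
      show "eventually (\<lambda>t. t powr \<alpha> * mittag_leffler \<alpha> 2 (- (t powr \<alpha>)) =
              t powr - (1 - \<alpha>) * (t * mittag_leffler \<alpha> 2 (- (t powr \<alpha>)))) at_top"
        using eventually_gt_at_top[of 0] by eventually_elim (simp add: powr_diff)
    qed
  qed
  moreover have "(1 - \<alpha>) * (1 / Gamma (2 - \<alpha>)) = 1 / Gamma (1 - \<alpha>)"
  proof -
    have "1 - \<alpha> \<notin> \<int>\<^sub>\<le>\<^sub>0" using nonpos_Ints_nonpos[of "1 - \<alpha>"] assms by auto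
    from Gamma_plus1[OF this] have "Gamma (2 - \<alpha>) = (1 - \<alpha>) * Gamma (1 - \<alpha>)"
      by (simp add: algebra_simps)
    then show ?thesis using assms by simp
  qed
  ultimately have "((\<lambda>t. t powr \<alpha> * ?u t) \<longlongrightarrow> 1 / Gamma (1 - \<alpha>)) at_top" by simp
  moreover have "filterlim (\<lambda>x::real. x powr (1 / \<alpha>)) at_top at_top"
    using assms by real_asymp
  ultimately have "((\<lambda>x. (x powr (1 / \<alpha>)) powr \<alpha> * ?u (x powr (1 / \<alpha>))) \<longlongrightarrow> 1 / Gamma (1 - \<alpha>)) at_top"
    by (rule filterlim_compose)
  then show ?thesis
  proof (rule Lim_transform_eventually)
    show "eventually (\<lambda>x. (x powr (1 / \<alpha>)) powr \<alpha> * ?u (x powr (1 / \<alpha>)) = x * mittag_leffler \<alpha> 1 (- x)) at_top"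
      using eventually_gt_at_top[of 0] by eventually_elim (use assms in \<open>simp add: powr_powr\<close>)
  qed
qed

section \<open>Identification of the terminal time and the initial state\<close>

theorem mainTheorem1:
  fixes \<alpha> \<gamma> T T' :: real and lam u0 u0' f :: "nat \<Rightarrow> real"
  assumes "0 < \<alpha>" "\<alpha> < 1"
    and "dirichlet_spectrum lam"
    and "0 \<le> \<gamma>"
    and "in_Hdot lam (-2) f" "\<not> in_S lam \<gamma> f"
    and "0 < T" "0 < T'"
    and "in_L2 u0" "in_S lam (\<gamma> + 1) u0"
    and "in_L2 u0'" "in_S lam (\<gamma> + 1) u0'"
    and "sol_P \<alpha> lam u0 f T = sol_P \<alpha> lam u0' f T'"
  shows "T = T' \<and> u0 = u0'"
proof -
  let ?E = "\<lambda>t n. mittag_leffler \<alpha> 1 (- lam n * t powr \<alpha>)"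
  have lam: "lam n > 0" for n
    using assms(3) by (simp add: dirichlet_spectrum_def)
  have lam_top: "filterlim lam at_top sequentially"
    using assms(3) by (simp add: dirichlet_spectrum_def)
  define l where "l = 1 / Gamma (1 - \<alpha>)"
  have l: "l > 0" using assms Gamma_real_pos[of "1 - \<alpha>"] by (simp add: l_def)
  \<comment> \<open>Both solutions share the stationary part A^{-1} f, with coefficients
    \<open>f n / lam n\<close>; what remains is F(t) applied to u_0 - A^{-1} f.\<close>
  have sol: "?E T n * (u0 n - f n / lam n) = ?E T' n * (u0' n - f n / lam n)" for n
    using fun_cong[OF assms(13), of n] by (simp add: sol_P_def algebra_simps diff_divide_distrib)
  have E_lim: "(\<lambda>n. lam n * ?E t n) \<longlonglongrightarrow> l * t powr (- \<alpha>)" if "t > 0" for t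
  proof -
    have "filterlim (\<lambda>n. lam n * t powr \<alpha>) at_top sequentially"
      using that by (intro filterlim_at_top_mult_tendsto_pos[OF tendsto_const _ lam_top]) auto
    from filterlim_compose[OF mittag_leffler_asymptotics[OF assms(1,2)] this]
    have "(\<lambda>n. lam n * t powr \<alpha> * ?E t n) \<longlonglongrightarrow> l" by (simp add: l_def)
    from tendsto_mult[OF this tendsto_const[of "t powr (- \<alpha>)"]] show ?thesis
      using that by (simp add: powr_minus field_simps)
  qed
  have "T = T'"
  proof (rule ccontr)
    assume "T \<noteq> T'"
    \<comment> \<open>Scaling by \<open>lam n\<close> gives finite limits, which differ because T
      \<noteq> T'; so \<open>a n - b n\<close> is eventually a legitimate divisor.\<close>
    define a where "a n = lam n * ?E T n" for n
    define b where "b n = lam n * ?E T' n" for n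
    have a: "a \<longlonglongrightarrow> l * T powr (- \<alpha>)" and b: "b \<longlonglongrightarrow> l * T' powr (- \<alpha>)"
      unfolding a_def b_def using E_lim assms by auto
    have "T powr (- \<alpha>) \<noteq> T' powr (- \<alpha>)"
      using \<open>T \<noteq> T'\<close> assms powr_less_mono2_neg[of "- \<alpha>" T T'] powr_less_mono2_neg[of "- \<alpha>" T' T]
      by (cases T T' rule: linorder_cases) auto
    then have ne: "l * T powr (- \<alpha>) - l * T' powr (- \<alpha>) \<noteq> 0" using l by simp
    have S0: "(\<lambda>n. lam n powr (\<gamma> + 1) * v n) \<longlonglongrightarrow> 0" if "in_S lam (\<gamma> + 1) v" for v
    proof -
      have "(\<lambda>n. lam n powr (\<gamma> + 1) * \<bar>v n\<bar>) \<longlonglongrightarrow> 0" using that by (simp add: in_S_def)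
      then show ?thesis by (subst tendsto_rabs_zero_iff[symmetric]) (simp add: abs_mult)
    qed
    \<comment> \<open>The quotient is \<open>sol\<close> solved for
      \<open>lam n powr \<gamma> * f n\<close>. The decay of the initial data sends the numerator to
      0, while the denominator has a nonzero limit.\<close>
    have "(\<lambda>n. (a n * (lam n powr (\<gamma> + 1) * u0 n) - b n * (lam n powr (\<gamma> + 1) * u0' n)) / (a n - b n))
        \<longlonglongrightarrow> (l * T powr (- \<alpha>) * 0 - l * T' powr (- \<alpha>) * 0) / (l * T powr (- \<alpha>) - l * T' powr (- \<alpha>))"
      by (intro tendsto_intros a b S0 assms ne)
    then have "(\<lambda>n. (a n * (lam n powr (\<gamma> + 1) * u0 n) - b n * (lam n powr (\<gamma> + 1) * u0' n)) / (a n - b n)) \<longlonglongrightarrow> 0"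
      by simp
    moreover have "eventually (\<lambda>n. a n - b n \<noteq> 0) sequentially"
      using tendsto_imp_eventually_ne[OF tendsto_diff[OF a b] ne] .
    then have "eventually (\<lambda>n. (a n * (lam n powr (\<gamma> + 1) * u0 n) - b n * (lam n powr (\<gamma> + 1) * u0' n)) / (a n - b n)
        = lam n powr \<gamma> * f n) sequentially"
    proof eventually_elim
      case (elim n)
      have "lam n * (a n * u0 n - b n * u0' n) = (a n - b n) * f n"
      proof -
        have "lam n * (a n * u0 n - b n * u0' n) - (a n - b n) * f n
            = (lam n)\<^sup>2 * (?E T n * (u0 n - f n / lam n) - ?E T' n * (u0' n - f n / lam n))"
          using lam[of n] by (simp add: a_def b_def field_simps power2_eq_square)
        then show ?thesis using sol[of n] by simp
      qed
      then have "lam n powr \<gamma> * (lam n * (a n * u0 n - b n * u0' n)) = lam n powr \<gamma> * ((a n - b n) * f n)"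
        by simp
      then show ?case
        using elim lam[of n] by (simp add: powr_add field_simps)
    qed
    ultimately have "(\<lambda>n. lam n powr \<gamma> * f n) \<longlonglongrightarrow> 0"
      by (rule Lim_transform_eventually)
    then have "(\<lambda>n. lam n powr \<gamma> * \<bar>f n\<bar>) \<longlonglongrightarrow> 0"
      by (subst (asm) tendsto_rabs_zero_iff[symmetric]) (simp add: abs_mult)
    \<comment> \<open>As f has order -2 by hypothesis, it can lie outside S_\<gamma> only by
      violating this limit.\<close>
    then show False using assms by (simp add: in_S_def)
  qed
  \<comment> \<open>For equal times the two factors in \<open>sol\<close> coincide, and positivity
    allows them to be cancelled.\<close>
  moreover have "u0 n = u0' n" for n
  proof -
    have "?E T n > 0"
      using mittag_leffler_neg_pos[OF assms(1,2), of "lam n * T powr \<alpha>"] lam[of n] by simp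
    then show ?thesis using sol[of n] \<open>T = T'\<close> by simp
  qed
  ultimately show ?thesis by auto
qed

end
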